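(* Let $D\subset\mathbb C$ be an open disc centred at $0$ and let $X$ be a graphical isotropic minimal surface over $D$ with height function $h$; then $h$ is harmonic, and suppose it has the power series representation $h(x,y)=\sum_{n=0}^\infty(c_nz^n+\overline{c_n}\bar z^n)$, $z=x+iy\in D$. Let $c\in\mathbb R$, and assume that the $c$-deformed surface $S_c$ in $\mathbb R^3(c)$ is again graphical over $U=\Phi(\Omega)$ for a neighbourhood $\Omega\subset D$ of $0$, with height function $h_c$. Then for $x+iy\in U$, with $\zeta=\Phi^{-1}(x+iy)$, $$h_c(x,y)=2\operatorname{Re}(c_0)+2\operatorname{Re}(c_1\zeta)+\sum_{n=2}^\infty\left(c_n\zeta^n+\overline{c_n}\,\bar\zeta^n\right),$$ i.e. $h_c$ decomposes into a plane parallel to the $xy$-plane, the surface $2\operatorname{Re}(c_1\,\Phi^{-1}(x+iy))$, and an infinite sum of isotropic generalised Enneper surfaces composed with $\Phi^{-1}$.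
   Context: $\mathbb R^3(c)=(\mathbb R^3,\,dx^2+dy^2+c\,dz^2)$; for $c=0$ this is isotropic $3$-space, where a graph is isotropic minimal iff its height function is harmonic. The graph of $h$ has Weierstrass data $(1,G)$ with $G(z)=\sum_{n\ge1}nc_nz^{n-1}$, and its $c$-deformation is the zero mean curvature surface in $\mathbb R^3(c)$ $$S_c=\operatorname{Re}\int^z\begin{pmatrix} 1-cG^2 \\ -i(1+cG^2) \\ 2G \end{pmatrix}dw=\begin{pmatrix} X \\ Y \\ Z \end{pmatrix},$$ with third component normalised as $Z=\operatorname{Re}\big(2\sum_{n\ge0}c_nz^n\big)$. Put $\Phi(z)=X+iY=z-\overline{\int^zcG^2\,dw}$; the paper writes $\phi(z,\bar z)=(\Phi,\overline\Phi)$ and $\pi_1$ for the projection to the first component, so that $\pi_1\circ\phi^{-1}$ corresponds to $\Phi^{-1}$. "Graphical" means that $\Phi$ is injective on $\Omega$, so that $S_c$ is the graph over $U$ of $h_c=Z\circ\Phi^{-1}$. An isotropic generalised Enneper surface (of order $n-1$, $n\ge2$, up to scaling) is, up to translation, the graph of $c_nz^n+\overline{c_n}\bar z^n$, with Weierstrass data $(1,nc_nz^{n-1})$. *)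

theory Defs
  imports "HOL-Analysis.Analysis"
begin

text \<open>
  The \<open>xy\<close>-plane is identified with \<^typ>\<open>complex\<close> via \<open>z = x + iy\<close>; in particular height
  functions have type \<^typ>\<open>complex \<Rightarrow> real\<close>, and \<open>h(x,y)\<close> is \<open>h (Complex x y)\<close>.
  Parametrised surfaces in \<open>\<real>\<^sup>3(c)\<close> have type \<^typ>\<open>complex \<Rightarrow> real^3\<close>.
\<close>

definition dpartial :: "complex \<Rightarrow> (complex \<Rightarrow> 'a::real_normed_vector) \<Rightarrow> complex \<Rightarrow> 'a" where
  "dpartial v f z = vector_derivative (\<lambda>t. f (z + t *\<^sub>R v)) (at 0)"

abbreviation partial_x :: "(complex \<Rightarrow> 'a::real_normed_vector) \<Rightarrow> complex \<Rightarrow> 'a" where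
  "partial_x \<equiv> dpartial 1"

abbreviation partial_y :: "(complex \<Rightarrow> 'a::real_normed_vector) \<Rightarrow> complex \<Rightarrow> 'a" where
  "partial_y \<equiv> dpartial \<i>"

definition C1_on :: "complex set \<Rightarrow> (complex \<Rightarrow> 'a::real_normed_vector) \<Rightarrow> bool" where
  "C1_on D f \<longleftrightarrow> (\<forall>v\<in>{1, \<i>}.
     (\<forall>z\<in>D. (\<lambda>t::real. f (z + t *\<^sub>R v)) differentiable (at 0)) \<and> continuous_on D (dpartial v f))"

definition C2_on :: "complex set \<Rightarrow> (complex \<Rightarrow> 'a::real_normed_vector) \<Rightarrow> bool" where
  "C2_on D f \<longleftrightarrow> C1_on D f \<and> C1_on D (partial_x f) \<and> C1_on D (partial_y f)"

definition harmonic_on :: "complex set \<Rightarrow> (complex \<Rightarrow> real) \<Rightarrow> bool" where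
  "harmonic_on D h \<longleftrightarrow> C2_on D h \<and>
     (\<forall>z\<in>D. partial_x (partial_x h) z + partial_y (partial_y h) z = 0)"

definition form_c :: "real \<Rightarrow> real^3 \<Rightarrow> real^3 \<Rightarrow> real" where
  "form_c c u v = u$1 * v$1 + u$2 * v$2 + c * (u$3 * v$3)"

text \<open>
  The mean curvature of a surface in \<open>\<real>\<^sup>3(c)\<close> with non-degenerate induced metric is
  \<open>(E N - 2 F M + G L) / (2 (E G - F\<^sup>2))\<close> up to the normalisation of the normal, where the
  coefficients of the second fundamental form are here taken as the determinants
  \<open>L = det (S\<^sub>x, S\<^sub>y, S\<^sub>x\<^sub>x)\<close> etc.  For \<open>c \<noteq> 0\<close> one has \<open>det (S\<^sub>x, S\<^sub>y, v) = \<langle>\<nu>, v\<rangle>\<^sub>c\<close> for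
  a normal field \<open>\<nu>\<close>.  For \<open>c = 0\<close> the metric is degenerate and \<open>\<nu>\<close> does not exist, but the
  determinants are still the coefficients of the (relative) second fundamental form of isotropic
  geometry; for a graph \<open>(x, y, h)\<close> they are the second derivatives of \<open>h\<close>.
\<close>
definition zero_mean_curvature :: "real \<Rightarrow> complex set \<Rightarrow> (complex \<Rightarrow> real^3) \<Rightarrow> bool" where
  "zero_mean_curvature c D S \<longleftrightarrow> C2_on D S \<and>
     (\<forall>z\<in>D.
        let Sx = partial_x S z; Sy = partial_y S z;
            E = form_c c Sx Sx; F = form_c c Sx Sy; G = form_c c Sy Sy;
            sff = (\<lambda>v. det (vector [Sx, Sy, v] :: real^3^3));
            L = sff (partial_x (partial_x S) z);
            M = sff (partial_x (partial_y S) z);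
            N = sff (partial_y (partial_y S) z)
        in E * G - F\<^sup>2 \<noteq> 0 \<and> E * N - 2 * F * M + G * L = 0)"

definition graph_surface :: "(complex \<Rightarrow> real) \<Rightarrow> complex \<Rightarrow> real^3" where
  "graph_surface h z = vector [Re z, Im z, h z]"

definition isotropic_minimal_graph :: "complex set \<Rightarrow> (complex \<Rightarrow> real) \<Rightarrow> bool" where
  "isotropic_minimal_graph D h \<longleftrightarrow> zero_mean_curvature 0 D (graph_surface h)"

definition weierstrass_integrand :: "real \<Rightarrow> (complex \<Rightarrow> complex) \<Rightarrow> complex \<Rightarrow> complex^3" where
  "weierstrass_integrand c G z =
     vector [1 - of_real c * (G z)\<^sup>2, - \<i> * (1 + of_real c * (G z)\<^sup>2), 2 * G z]"

text \<open>
  \<open>S = Re \<integral>\<^sup>z (1 - cG\<^sup>2, -i(1 + cG\<^sup>2), 2G) dw\<close> on \<open>D\<close>, i.e. the surface in \<open>\<real>\<^sup>3(c)\<close> with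
  Weierstrass data \<open>(1, G)\<close>.  The indefinite integral is an arbitrary primitive, so this
  determines \<open>S\<close> up to a translation when \<open>D\<close> is connected.
\<close>
definition weierstrass_surface ::
    "real \<Rightarrow> (complex \<Rightarrow> complex) \<Rightarrow> complex set \<Rightarrow> (complex \<Rightarrow> real^3) \<Rightarrow> bool" where
  "weierstrass_surface c G D S \<longleftrightarrow> (\<exists>P :: complex \<Rightarrow> complex^3. \<forall>z\<in>D. \<forall>k.
     ((\<lambda>w. P w $ k) has_field_derivative weierstrass_integrand c G z $ k) (at z) \<and>
     S z $ k = Re (P z $ k))"

text \<open>\<open>G(z) = \<Sum>\<^sub>n\<^sub>\<ge>\<^sub>1 n a\<^sub>n z\<^sup>n\<^sup>-\<^sup>1\<close>, with the summation index shifted by one.\<close>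
definition weierstrass_G :: "(nat \<Rightarrow> complex) \<Rightarrow> complex \<Rightarrow> complex" where
  "weierstrass_G a z = (\<Sum>n. of_nat (Suc n) * a (Suc n) * z ^ n)"

text \<open>
  The \<open>c\<close>-deformation over \<open>D\<close> of the graph of \<open>h = 2 Re (\<Sum>n. a\<^sub>n z\<^sup>n)\<close>.  The integration
  constants of the first two components are left free, which matches
  \<open>\<Phi> = z - conj (\<integral>\<^sup>z c G\<^sup>2 dw)\<close> with an indefinite integral.
\<close>
definition c_deformation ::
    "real \<Rightarrow> (nat \<Rightarrow> complex) \<Rightarrow> complex set \<Rightarrow> (complex \<Rightarrow> real^3) \<Rightarrow> bool" where
  "c_deformation c a D S \<longleftrightarrow> weierstrass_surface c (weierstrass_G a) D S \<and>
     (\<forall>z\<in>D. S z $ 3 = Re (2 * (\<Sum>n. a n * z ^ n)))"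

definition proj :: "(complex \<Rightarrow> real^3) \<Rightarrow> complex \<Rightarrow> complex" where
  "proj S z = Complex (S z $ 1) (S z $ 2)"

definition graphical_on :: "complex set \<Rightarrow> (complex \<Rightarrow> real^3) \<Rightarrow> bool" where
  "graphical_on \<Omega> S \<longleftrightarrow> inj_on (proj S) \<Omega>"

definition proj_inv :: "complex set \<Rightarrow> (complex \<Rightarrow> real^3) \<Rightarrow> complex \<Rightarrow> complex" where
  "proj_inv \<Omega> S = the_inv_into \<Omega> (proj S)"

definition height_function :: "complex set \<Rightarrow> (complex \<Rightarrow> real^3) \<Rightarrow> complex \<Rightarrow> real" where
  "height_function \<Omega> S w = S (proj_inv \<Omega> S w) $ 3"

lemma graphical_on_imp_graph:
  assumes "graphical_on \<Omega> S"
  shows "S ` \<Omega> = graph_surface (height_function \<Omega> S) ` (proj S ` \<Omega>)"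
proof -
  have "S z = graph_surface (height_function \<Omega> S) (proj S z)" if "z \<in> \<Omega>" for z
  proof -
    have "height_function \<Omega> S (proj S z) = S z $ 3"
      using assms that
      by (simp add: graphical_on_def height_function_def proj_inv_def the_inv_into_f_f)
    then show ?thesis
      by (simp add: graph_surface_def vec_eq_iff forall_3 proj_def)
  qed
  then show ?thesis by (simp add: image_image)
qed

text \<open>
  \<open>S\<close> is an isotropic generalised Enneper surface of order \<open>m\<close>: an isotropic surface with
  Weierstrass data \<open>(1, n b z\<^sup>n\<^sup>-\<^sup>1)\<close>, where \<open>n = m + 1 \<ge> 2\<close> and \<open>b \<noteq> 0\<close> is the scaling.
  The translation is absorbed in the choice of primitives.
\<close>
definition isotropic_generalised_enneper :: "nat \<Rightarrow> (complex \<Rightarrow> real^3) \<Rightarrow> bool" where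
  "isotropic_generalised_enneper m S \<longleftrightarrow> m \<ge> 1 \<and>
     (\<exists>b::complex. b \<noteq> 0 \<and> weierstrass_surface 0 (\<lambda>z. of_nat (m + 1) * b * z ^ m) UNIV S)"

end

theory Submission
  imports Defs
begin

text \<open>
  Harmonicity of \<open>h\<close> is the isotropic minimal surface equation of a graph, since the induced metric
  is \<open>dx\<^sup>2 + dy\<^sup>2\<close> and the second fundamental form is the Hessian of \<open>h\<close>.  The height of \<open>S\<close> over
  \<open>\<Phi> \<zeta>\<close> is \<open>2 Re (\<Sum>n. a\<^sub>n \<zeta>\<^sup>n)\<close>, so the decomposition amounts to splitting off the first
  two terms.  The analytic point is that the series for \<open>h\<close> only gives convergence of the real parts:
  if \<open>Re (a\<^sub>n z\<^sup>n) \<longlonglongrightarrow> 0\<close> at \<open>z = \<rho>\<close> and at \<open>z = \<rho> exp (i \<pi> \<surd>2)\<close>, then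
  \<open>\<bar>sin (n \<pi> \<surd>2)\<bar> \<ge> 1 / (2 n)\<close> (as \<open>\<surd>2\<close> is badly approximable) forces \<open>a\<^sub>n \<rho>\<^sup>n = O(n)\<close>.
\<close>

section \<open>Convergence of the complex series from its real parts\<close>

lemma jordan_sin_inequality:
  fixes x :: real
  assumes "0 \<le> x" "x \<le> 1/2"
  shows "2 * x \<le> sin (pi * x)"
proof -
  have "concave_on {0..pi/2} sin"
  proof (rule f''_le0_imp_concave)
    show "(sin has_real_derivative cos x) (at x)" for x :: real
      by (rule DERIV_sin)
    show "(cos has_real_derivative - sin x) (at x)" for x :: real
      by (rule DERIV_cos)
    show "- sin x \<le> 0" if "x \<in> {0..pi/2}" for x :: real
      using that by (simp add: sin_ge_zero)
  qed simp
  \<comment> \<open>On \<open>{0..pi/2}\<close> the sine lies above its chord, here taken at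
    parameter \<open>2 * x\<close>, where the chord has height \<open>2 * x\<close>.\<close>
  from concave_onD[OF this, of "2 * x" 0 "pi/2"] assms show ?thesis
    by (simp add: mult_ac)
qed

text \<open>The nonzero integer \<open>2 n^2 - m^2\<close> has absolute value at least 1 and factors
  as \<open>(n sqrt 2 + m) (n sqrt 2 - m)\<close>; the first factor is at most \<open>4 n\<close> in
  absolute value when \<open>m\<close> is within 1/2 of \<open>n sqrt 2\<close>.\<close>

lemma sqrt2_badly_approximable:
  fixes n :: nat and m :: int
  assumes "n > 0" "\<bar>real n * sqrt 2 - of_int m\<bar> \<le> 1/2"
  shows "1 \<le> 4 * real n * \<bar>real n * sqrt 2 - of_int m\<bar>"
proof -
  have "m\<^sup>2 \<noteq> 2 * (int n)\<^sup>2"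
  proof
    assume eq: "m\<^sup>2 = 2 * (int n)\<^sup>2"
    then have "m \<noteq> 0" using assms by auto
    \<comment> \<open>The exponent of 2 is even on the left and odd on the right.\<close>
    have "multiplicity 2 (m\<^sup>2) = multiplicity 2 (2 * (int n)\<^sup>2)" using eq by simp
    then have "2 * multiplicity 2 m = Suc (2 * multiplicity 2 (int n))"
      using assms \<open>m \<noteq> 0\<close>
      by (simp add: prime_elem_multiplicity_power_distrib prime_elem_multiplicity_mult_distrib)
    then show False by presburger
  qed
  then have "1 \<le> \<bar>2 * (int n)\<^sup>2 - m\<^sup>2\<bar>" by linarith
  then have "1 \<le> \<bar>real_of_int (2 * (int n)\<^sup>2 - m\<^sup>2)\<bar>" by linarith
  also have "real_of_int (2 * (int n)\<^sup>2 - m\<^sup>2)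
      = (real n * sqrt 2 + of_int m) * (real n * sqrt 2 - of_int m)"
    by (simp add: algebra_simps power2_eq_square)
  also have "\<bar>\<dots>\<bar> = \<bar>real n * sqrt 2 + of_int m\<bar> * \<bar>real n * sqrt 2 - of_int m\<bar>"
    by (rule abs_mult)
  also have "\<dots> \<le> (4 * real n) * \<bar>real n * sqrt 2 - of_int m\<bar>"
  proof (rule mult_right_mono)
    \<comment> \<open>The first factor is at most \<open>2 n sqrt 2 + 1/2\<close>, hence at most
      \<open>3 n + 1/2\<close>.\<close>
    have "sqrt 2 \<le> 3/2" by (rule real_le_lsqrt) (auto simp: power2_eq_square)
    then have "real n * sqrt 2 \<le> real n * (3/2)" by (intro mult_left_mono) auto
    moreover have "real n \<ge> 1" using assms by simp
    moreover have "real n * sqrt 2 \<ge> 0" by simp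
    ultimately show "\<bar>real n * sqrt 2 + of_int m\<bar> \<le> 4 * real n"
      using assms(2) by linarith
  qed simp
  finally show ?thesis .
qed

text \<open>Removing the nearest integer \<open>m\<close> from \<open>n sqrt 2\<close> changes the
  sine only by a sign. The remainder \<open>d\<close> satisfies \<open>|d| >= 1 / (4 n)\<close>, and
  the sine is at least \<open>2 |d|\<close> in absolute value.\<close>

lemma abs_sin_pi_sqrt2_ge:
  fixes n :: nat
  assumes "n > 0"
  shows "1 \<le> 2 * real n * \<bar>sin (real n * (pi * sqrt 2))\<bar>"
proof -
  define m where "m = round (real n * sqrt 2)"
  define d where "d = real n * sqrt 2 - of_int m"
  have d: "\<bar>d\<bar> \<le> 1/2"
    using of_int_round_abs_le[of "real n * sqrt 2"] by (simp add: d_def m_def abs_minus_commute)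
  have "real n * (pi * sqrt 2) = pi * d + pi * of_int m"
    by (simp add: d_def algebra_simps)
  then have "\<bar>sin (real n * (pi * sqrt 2))\<bar> = \<bar>sin (pi * d)\<bar>"
    by (simp add: sin_add abs_mult)
  also have "\<dots> \<ge> 2 * \<bar>d\<bar>"
    using jordan_sin_inequality[of "\<bar>d\<bar>"] d by (cases "d \<ge> 0") auto
  finally have "2 * real n * (2 * \<bar>d\<bar>) \<le> 2 * real n * \<bar>sin (real n * (pi * sqrt 2))\<bar>"
    by (intro mult_left_mono) auto
  then show ?thesis
    using sqrt2_badly_approximable[OF assms d[unfolded d_def]] by (simp add: d_def)
qed

text \<open>The rotated real part is \<open>Re w cos t - Im w sin t\<close>, so the two bounds give
  \<open>|Im w sin t| <= 2 B\<close>. The lower bound on the sine turns this into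
  \<open>|Im w| <= 4 B n\<close>, and \<open>|Re w| <= B n\<close> makes up the constant 5.\<close>

lemma norm_le_of_Re_rotations:
  fixes w :: complex
  assumes n: "n > 0" and B: "\<bar>Re w\<bar> \<le> B" "\<bar>Re (w * cis (real n * (pi * sqrt 2)))\<bar> \<le> B"
  shows "norm w \<le> 5 * B * real n"
proof -
  let ?t = "real n * (pi * sqrt 2)"
  have "B \<ge> 0" using B(1) by linarith
  then have "\<bar>Re w * cos ?t\<bar> \<le> B * 1"
    unfolding abs_mult by (intro mult_mono B) auto
  moreover have "Re (w * cis ?t) = Re w * cos ?t - Im w * sin ?t" by simp
  ultimately have "\<bar>Im w * sin ?t\<bar> \<le> 2 * B" using B(2) by linarith
  then have s: "2 * real n * (\<bar>Im w\<bar> * \<bar>sin ?t\<bar>) \<le> 2 * real n * (2 * B)"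
    by (intro mult_left_mono) (auto simp: abs_mult)
  have "\<bar>Im w\<bar> * 1 \<le> \<bar>Im w\<bar> * (2 * real n * \<bar>sin ?t\<bar>)"
    using abs_sin_pi_sqrt2_ge[OF n] by (intro mult_left_mono) auto
  with s have "\<bar>Im w\<bar> \<le> 4 * B * real n" by (simp add: mult_ac)
  moreover have "B * 1 \<le> B * real n"
    using n \<open>B \<ge> 0\<close> by (intro mult_left_mono) auto
  ultimately show ?thesis
    using cmod_le[of w] B(1) by linarith
qed

lemma summable_powser_of_summable_Re:
  fixes a :: "nat \<Rightarrow> complex"
  assumes Re: "\<And>z. norm z < r \<Longrightarrow> summable (\<lambda>n. Re (a n * z ^ n))" and z: "norm z < r"
  shows "summable (\<lambda>n. a n * z ^ n)"
proof -
  obtain \<rho> where \<rho>: "norm z < \<rho>" "\<rho> < r" using z dense by blast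
  then have "\<rho> > 0" using norm_ge_zero[of z] by linarith
  let ?w = "\<lambda>n. a n * of_real \<rho> ^ n"
  have bounded: "\<exists>B. \<forall>n. \<bar>Re (a n * u ^ n)\<bar> \<le> B" if "norm u < r" for u
  proof -
    have "Bseq (\<lambda>n. Re (a n * u ^ n))"
      by (rule convergent_imp_Bseq[OF convergentI[OF summable_LIMSEQ_zero[OF Re[OF that]]]])
    then show ?thesis unfolding Bseq_def real_norm_def by blast
  qed
  obtain B1 where B1: "\<And>n. \<bar>Re (?w n)\<bar> \<le> B1"
    using bounded[of "of_real \<rho>"] \<rho> \<open>\<rho> > 0\<close> by auto
  obtain B2 where B2: "\<And>n. \<bar>Re (a n * (of_real \<rho> * cis (pi * sqrt 2)) ^ n)\<bar> \<le> B2"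
    using bounded[of "of_real \<rho> * cis (pi * sqrt 2)"] \<rho> \<open>\<rho> > 0\<close> by (auto simp: norm_mult)
  define B where "B = max B1 B2"
  have w: "norm (?w n) \<le> 5 * B * real n" if "n > 0" for n
  proof (rule norm_le_of_Re_rotations[OF that])
    show "\<bar>Re (?w n)\<bar> \<le> B" using B1[of n] unfolding B_def by linarith
    \<comment> \<open>By de Moivre, moving the base point by the fixed angle
      \<open>pi sqrt 2\<close> rotates the term of index \<open>n\<close> by \<open>n\<close> times
      that angle.\<close>
    have "?w n * cis (real n * (pi * sqrt 2)) = a n * (of_real \<rho> * cis (pi * sqrt 2)) ^ n"
      by (simp only: power_mult_distrib Complex.DeMoivre mult.assoc)
    then show "\<bar>Re (?w n * cis (real n * (pi * sqrt 2)))\<bar> \<le> B"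
      using B2[of n] by (simp only: B_def le_max_iff_disj simp_thms)
  qed
  have "B \<ge> 0" using B1[of 0] by (simp add: B_def)
  let ?q = "norm z / \<rho>"
  \<comment> \<open>The majorant is a multiple of the differentiated geometric series with ratio
    \<open>norm z / \<rho> < 1\<close>. The comparison starts at \<open>n = 1\<close>, since the
    bound on \<open>?w n\<close> is only for positive \<open>n\<close>.\<close>
  have "summable (\<lambda>n. 5 * B * (real (Suc n) * ?q ^ n))"
    using geometric_deriv_sums[of ?q] \<rho> \<open>\<rho> > 0\<close> by (intro summable_mult) (auto simp: sums_iff)
  moreover have "norm (a n * z ^ n) \<le> 5 * B * (real (Suc n) * ?q ^ n)" if "n \<ge> 1" for n
  proof -
    have "norm (a n * z ^ n) = norm (?w n) * ?q ^ n"
      using \<open>\<rho> > 0\<close> by (simp add: norm_mult norm_power power_divide)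
    also have "\<dots> \<le> (5 * B * real (Suc n)) * ?q ^ n"
    proof (rule mult_right_mono)
      have "5 * B * real n \<le> 5 * B * real (Suc n)"
        using \<open>B \<ge> 0\<close> by (intro mult_left_mono) auto
      with w[of n] that show "norm (?w n) \<le> 5 * B * real (Suc n)" by simp
    qed (use \<open>\<rho> > 0\<close> in simp)
    finally show ?thesis by (simp only: mult.assoc)
  qed
  ultimately show ?thesis by (rule summable_comparison_test'[where N = 1])
qed

section \<open>Real form of the summands, partial derivatives and harmonicity\<close>

lemma add_cnj_power: "a * z ^ n + cnj a * cnj z ^ n = of_real (2 * Re (a * z ^ n))"
  by (simp only: complex_add_cnj[symmetric] complex_cnj_mult complex_cnj_power)

text \<open>Used with \<open>L\<close> a coordinate of \<open>real^3\<close>. Agreement of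
  \<open>f\<close> with \<open>L\<close> after \<open>F\<close> on \<open>D\<close> alone suffices
  because short segments through a point of the open set \<open>D\<close> stay inside. This allows
  iteration: the coordinates of the first partials are identified only on \<open>D\<close>.\<close>

lemma
  fixes F :: "complex \<Rightarrow> 'a::real_normed_vector" and f :: "complex \<Rightarrow> 'b::real_normed_vector"
  assumes D: "open D" and L: "bounded_linear L" and F: "C1_on D F"
    and f: "\<And>z. z \<in> D \<Longrightarrow> f z = L (F z)"
  shows dpartial_bounded_linear:
      "\<And>z v. z \<in> D \<Longrightarrow> v \<in> {1, \<i>} \<Longrightarrow> dpartial v f z = L (dpartial v F z)"
    and C1_on_bounded_linear: "C1_on D f"
proof -
  have deriv: "((\<lambda>t. f (z + t *\<^sub>R v)) has_vector_derivative L (dpartial v F z)) (at 0)"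
    if "z \<in> D" "v \<in> {1, \<i>}" for z v
  proof (rule has_vector_derivative_transform_within_open)
    have "((\<lambda>t. F (z + t *\<^sub>R v)) has_vector_derivative dpartial v F z) (at 0)"
      using F that unfolding C1_on_def dpartial_def vector_derivative_works[symmetric] by blast
    then show "((\<lambda>t. L (F (z + t *\<^sub>R v))) has_vector_derivative L (dpartial v F z)) (at 0)"
      by (rule bounded_linear.has_vector_derivative[OF L])
    show "open ((\<lambda>t::real. z + t *\<^sub>R v) -` D)"
      by (intro open_vimage D continuous_intros)
  qed (use that f in auto)
  then show partial: "dpartial v f z = L (dpartial v F z)" if "z \<in> D" "v \<in> {1, \<i>}" for z v
    using that unfolding dpartial_def[of v f] by (blast intro: vector_derivative_at)
  show "C1_on D f"
    unfolding C1_on_def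
  proof (intro ballI conjI)
    fix v :: complex assume v: "v \<in> {1, \<i>}"
    show "(\<lambda>t::real. f (z + t *\<^sub>R v)) differentiable at 0" if "z \<in> D" for z
      using deriv[OF that v] by (rule differentiableI_vector)
    have "continuous_on D (\<lambda>z. L (dpartial v F z))"
      using F v by (intro bounded_linear.continuous_on[OF L]) (auto simp: C1_on_def)
    then show "continuous_on D (dpartial v f)"
      using partial[OF _ v] by (simp cong: continuous_on_cong)
  qed
qed

lemma dpartial_vec_nth:
  fixes S :: "complex \<Rightarrow> real^3"
  assumes "open D" "C1_on D S" "z \<in> D" "v \<in> {1, \<i>}"
  shows "dpartial v S z $ k = dpartial v (\<lambda>w. S w $ k) z"
  using dpartial_bounded_linear[OF assms(1) bounded_linear_vec_nth assms(2) refl assms(3,4)] by simp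

lemma dpartial_eq:
  assumes "((\<lambda>t. f (z + t *\<^sub>R v)) has_vector_derivative d) (at 0)"
  shows "dpartial v f z = d"
  unfolding dpartial_def using assms by (rule vector_derivative_at)

lemma dpartial_const: "dpartial v (\<lambda>_. k) z = 0"
  by (rule dpartial_eq) (rule has_vector_derivative_const)

lemma dpartial_Re: "dpartial v Re z = Re v"
  by (rule dpartial_eq) (auto intro!: derivative_eq_intros)

lemma dpartial_Im: "dpartial v Im z = Im v"
  by (rule dpartial_eq) (auto intro!: derivative_eq_intros)

text \<open>The first partials are \<open>(1, 0, h_x)\<close> and \<open>(0, 1, h_y)\<close>, the
  second ones \<open>(0, 0, h_uv)\<close>. So \<open>E = G = 1\<close>, \<open>F = 0\<close>, the
  determinants are the \<open>h_uv\<close>, and the curvature equation is Laplace's. The regularity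
  of \<open>h\<close> is that of the third coordinate.\<close>

lemma isotropic_minimal_graph_imp_harmonic_on:
  assumes D: "open D" and min: "isotropic_minimal_graph D h"
  shows "harmonic_on D h"
proof -
  let ?S = "graph_surface h"
  have C2: "C1_on D ?S" "C1_on D (partial_x ?S)" "C1_on D (partial_y ?S)"
    using min by (auto simp: isotropic_minimal_graph_def zero_mean_curvature_def C2_on_def)
  have C1: "C1_on D (dpartial v ?S)" if "v \<in> {1, \<i>}" for v
    using C2 that by auto
  note nth = bounded_linear_vec_nth
  have comp: "(\<lambda>w. ?S w $ 1) = Re" "(\<lambda>w. ?S w $ 2) = Im" "(\<lambda>w. ?S w $ 3) = h"
    by (auto simp: graph_surface_def)
  have first: "dpartial v ?S z $ 1 = Re v" "dpartial v ?S z $ 2 = Im v"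
      "dpartial v ?S z $ 3 = dpartial v h z" if "z \<in> D" "v \<in> {1, \<i>}" for z v
    using dpartial_vec_nth[OF D C2(1) that] by (simp_all add: comp dpartial_Re dpartial_Im)
  have second: "dpartial u (dpartial v ?S) z $ 1 = 0" "dpartial u (dpartial v ?S) z $ 2 = 0"
      "dpartial u (dpartial v ?S) z $ 3 = dpartial u (dpartial v h) z"
    if z: "z \<in> D" and u: "u \<in> {1, \<i>}" and v: "v \<in> {1, \<i>}" for z u v
    using dpartial_bounded_linear[OF D nth C1[OF v] first(1)[OF _ v, symmetric] z u]
      dpartial_bounded_linear[OF D nth C1[OF v] first(2)[OF _ v, symmetric] z u]
      dpartial_bounded_linear[OF D nth C1[OF v] first(3)[OF _ v, symmetric] z u]
    by (simp_all add: dpartial_const)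
  have "C1_on D h"
    by (rule C1_on_bounded_linear[OF D nth C2(1) comp(3)[THEN fun_cong, symmetric]])
  moreover have "C1_on D (dpartial v h)" if "v \<in> {1, \<i>}" for v
    by (rule C1_on_bounded_linear[OF D nth C1[OF that] first(3)[OF _ that, symmetric]])
  ultimately have "C2_on D h" by (simp add: C2_on_def)
  moreover have "partial_x (partial_x h) z + partial_y (partial_y h) z = 0" if "z \<in> D" for z
  proof -
    note dirs = insertI1[of "1 :: complex" "{\<i>}"] insertI2[OF singletonI[of \<i>], of 1]
    show ?thesis
      using min[unfolded isotropic_minimal_graph_def zero_mean_curvature_def, THEN conjunct2,
          THEN bspec, OF that]
      by (simp add: Let_def form_c_def det_3
          first[OF that dirs(1)] first[OF that dirs(2)]
          second[OF that dirs(1,1)] second[OF that dirs(2,2)] second[OF that dirs(1,2)])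
  qed
  ultimately show ?thesis by (simp add: harmonic_on_def)
qed

section \<open>Enneper summands and the decomposition\<close>

lemma isotropic_generalised_enneper_power_graph:
  assumes "n \<ge> 2" "b \<noteq> 0"
  shows "isotropic_generalised_enneper (n - 1)
    (graph_surface (\<lambda>z. Re (b * z ^ n + cnj b * cnj z ^ n)))"
proof -
  \<comment> \<open>A primitive of \<open>(1, -i, 2 n b z^(n-1))\<close>, with real parts
    \<open>x\<close>, \<open>y\<close> and \<open>2 Re (b z^n)\<close>.\<close>
  let ?P = "\<lambda>z. vector [z, - \<i> * z, 2 * b * z ^ n] :: complex^3"
  obtain m where n: "n = Suc m" using assms by (cases n) auto
  have "weierstrass_surface 0 (\<lambda>z. of_nat (m + 1) * b * z ^ m) UNIV
      (graph_surface (\<lambda>z. Re (b * z ^ n + cnj b * cnj z ^ n)))"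
    unfolding weierstrass_surface_def
  proof (intro exI[of _ ?P] ballI)
    fix z
    show "\<forall>k. ((\<lambda>w. ?P w $ k) has_field_derivative
          weierstrass_integrand 0 (\<lambda>z. of_nat (m + 1) * b * z ^ m) z $ k) (at z) \<and>
        graph_surface (\<lambda>z. Re (b * z ^ n + cnj b * cnj z ^ n)) z $ k = Re (?P z $ k)"
      unfolding forall_3 add_cnj_power
      by (auto simp: weierstrass_integrand_def graph_surface_def n mult.assoc simp del: power_Suc
          intro!: derivative_eq_intros)
  qed
  then show ?thesis
    using assms by (auto simp: isotropic_generalised_enneper_def n)
qed

theorem theorem4p6:
  fixes r c :: real and a :: "nat \<Rightarrow> complex" and h :: "complex \<Rightarrow> real"
    and S :: "complex \<Rightarrow> real^3" and \<Omega> :: "complex set"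
  assumes "r > 0"
    and "isotropic_minimal_graph (ball 0 r) h"
    and "\<And>z. z \<in> ball 0 r \<Longrightarrow>
      (\<lambda>n. a n * z ^ n + cnj (a n) * cnj z ^ n) sums complex_of_real (h z)"
    and "c_deformation c a (ball 0 r) S"
    and "0 \<in> interior \<Omega>" and "\<Omega> \<subseteq> ball 0 r"
    and "graphical_on \<Omega> S"
  shows "harmonic_on (ball 0 r) h \<and>
    (\<forall>x y. Complex x y \<in> proj S ` \<Omega> \<longrightarrow>
      (let \<zeta> = proj_inv \<Omega> S (Complex x y);
           e = (\<lambda>n z. a n * z ^ n + cnj (a n) * cnj z ^ n)
       in summable (\<lambda>n. e (n + 2) \<zeta>) \<and>
          complex_of_real (height_function \<Omega> S (Complex x y)) =
            of_real (2 * Re (a 0)) + of_real (2 * Re (a 1 * \<zeta>)) + (\<Sum>n. e (n + 2) \<zeta>))) \<and>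
    (\<forall>n\<ge>2. a n \<noteq> 0 \<longrightarrow>
      isotropic_generalised_enneper (n - 1)
        (graph_surface (\<lambda>z. Re (a n * z ^ n + cnj (a n) * cnj z ^ n))))"
proof (intro conjI allI impI)
  let ?e = "\<lambda>n z. a n * z ^ n + cnj (a n) * cnj z ^ n"
  show "harmonic_on (ball 0 r) h"
    using assms(2) by (intro isotropic_minimal_graph_imp_harmonic_on) auto
  show "isotropic_generalised_enneper (n - 1) (graph_surface (\<lambda>z. Re (?e n z)))"
    if "n \<ge> 2" "a n \<noteq> 0" for n
    using that by (rule isotropic_generalised_enneper_power_graph)
  fix x y
  assume "Complex x y \<in> proj S ` \<Omega>"
  define \<zeta> where "\<zeta> = proj_inv \<Omega> S (Complex x y)"
  have "\<zeta> \<in> \<Omega>"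
    unfolding \<zeta>_def proj_inv_def
    using assms(7) \<open>Complex x y \<in> proj S ` \<Omega>\<close>
    by (intro the_inv_into_into) (auto simp: graphical_on_def)
  then have \<zeta>: "\<zeta> \<in> ball 0 r" using assms(6) by blast
  \<comment> \<open>Each summand of the series for \<open>h\<close> equals
    \<open>2 Re (a n * z ^ n)\<close>, so the hypothesis controls real parts only.\<close>
  have "summable (\<lambda>n. Re (a n * z ^ n))" if "norm z < r" for z
  proof -
    from that assms(3)[of z] have "summable (\<lambda>n. complex_of_real (2 * Re (a n * z ^ n)))"
      by (simp only: add_cnj_power) (auto simp: sums_iff)
    then have "summable (\<lambda>n. 2 * Re (a n * z ^ n))"
      by (simp only: summable_complex_of_real)
    then show ?thesis by (subst (asm) summable_cmult_iff) simp
  qed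
  \<comment> \<open>The third coordinate of \<open>S\<close> is the real part of a complex
    \<open>suminf\<close>; convergence is what allows taking real parts termwise.\<close>
  then have "summable (\<lambda>n. a n * \<zeta> ^ n)"
    by (rule summable_powser_of_summable_Re) (use \<zeta> in simp_all)
  then have "(\<lambda>n. 2 * Re (a n * \<zeta> ^ n)) sums (2 * Re (\<Sum>n. a n * \<zeta> ^ n))"
    by (intro sums_mult sums_Re summable_sums)
  also have "2 * Re (\<Sum>n. a n * \<zeta> ^ n) = height_function \<Omega> S (Complex x y)"
    using assms(4) \<zeta> by (simp add: c_deformation_def height_function_def \<zeta>_def[symmetric])
  finally have sums: "(\<lambda>n. ?e n \<zeta>) sums of_real (height_function \<Omega> S (Complex x y))"
    unfolding add_cnj_power by (rule sums_of_real)
  then have summable: "summable (\<lambda>n. ?e (n + 2) \<zeta>)"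
    by (intro summable_ignore_initial_segment sums_summable)
  \<comment> \<open>The terms of index 0 and 1 are the plane and the linear term in
    \<open>\<zeta>\<close>; the rest is reindexed by \<open>n + 2\<close>.\<close>
  have "of_real (height_function \<Omega> S (Complex x y)) =
      (\<Sum>n. ?e (n + 2) \<zeta>) + (\<Sum>n<2. ?e n \<zeta>)"
    using sums suminf_split_initial_segment[OF sums_summable[OF sums], of 2]
    by (simp only: sums_unique[symmetric])
  also have "(\<Sum>n<2. ?e n \<zeta>) = of_real (2 * Re (a 0)) + of_real (2 * Re (a 1 * \<zeta>))"
    unfolding add_cnj_power by (simp add: numeral_2_eq_2)
  finally show "let \<zeta> = proj_inv \<Omega> S (Complex x y); e = ?e
      in summable (\<lambda>n. e (n + 2) \<zeta>) \<and>
        complex_of_real (height_function \<Omega> S (Complex x y)) =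
          of_real (2 * Re (a 0)) + of_real (2 * Re (a 1 * \<zeta>)) + (\<Sum>n. e (n + 2) \<zeta>)"
    using summable unfolding Let_def \<zeta>_def[symmetric] by (simp add: add_ac)
qed

end
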